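(* Let $\mathcal{X}=[0,1]^d$ with base measure $\mu$ equal to Lebesgue measure $\lambda$ (so that $\mu(\mathcal{X})<\infty$), and let $\{\phi_z\}_{z\in\mathcal{Z}}$ be an orthonormal basis of $L^2_\lambda(\mathcal{X})$, indexed by a countable family $\mathcal{Z}$ and consisting of bounded functions $\phi_z:\mathcal{X}\to\mathbb{R}$. Suppose that there exist constants $L_D,L_G>0$ and real-valued nets $\{a_z\}_{z\in\mathcal{Z}}$, $\{b_z\}_{z\in\mathcal{Z}}$ such that $\mathcal{F}_D=\mathcal{H}_{p,a}(L_D)$ (the discriminator class) and $\mathcal{F}_G=\mathcal{H}_{q,b}(L_G)$ (the class of distributions), where $p,q\ge 1$. Let $p'=\frac{p}{p-1}$ denote the Hölder conjugate of $p$. Let $Z\subseteq\mathcal{Z}$ be finite, and let $\widehat P=\widehat P_Z$ be the truncated series estimator computed from $n$ i.i.d. observations $X_{1:n}=(X_1,\dots,X_n)$ with law $P$. Then, for any $P\in\mathcal{F}_G$, $$\mathbb{E}_{X_{1:n}}\left[d_{\mathcal{F}_D}\left(P,\widehat P\right)\right]\le L_D\frac{c_{p'}}{\sqrt n}\left\|\left\{\frac{\|\phi_z\|_{L^\infty_P}}{a_z}\right\}_{z\in Z}\right\|_{p'}+L_DL_G\left\|\left\{\frac{1}{a_zb_z}\right\}_{z\in\mathcal{Z}\setminus Z}\right\|_{\frac{1}{1-1/p-1/q}},$$ where $c_{p'}$ is a constant depending only on $p'$.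
   Context: Basis coefficients: for $f\in L^1(\mathcal{X})$, $\tilde f_z:=\int_{\mathcal{X}} f\phi_z\,d\mu$. For a Borel probability measure $P$ on $\mathcal{X}$ (not required to have a density), $\tilde P_z:=\mathbb{E}_{X\sim P}[\phi_z(X)]$. Generalized ellipses: for $p\ge1$, $L>0$ and a real-valued net $\{a_z\}_{z\in\mathcal{Z}}$, $\mathcal{H}_{p,a}(L)=\{f\in L^1(\mathcal{X}):(\sum_{z\in\mathcal{Z}}a_z^p|\tilde f_z|^p)^{1/p}\le L\}$. A discriminator class $\mathcal{F}_D$ is a class of bounded Borel-measurable functions on $\mathcal{X}$. A class $\mathcal{F}_G$ of distributions is a class of Borel probability measures on $\mathcal{X}$; for it, the condition defining $\mathcal{H}_{q,b}(L)$ is read with the coefficients $\tilde P_z$, that is, $(\sum_{z\in\mathcal{Z}}b_z^q|\tilde P_z|^q)^{1/q}\le L$. Adversarial loss: $d_{\mathcal{F}_D}(P,Q)=\sup_{f\in\mathcal{F}_D}\left|\mathbb{E}_{X\sim P}[f(X)]-\mathbb{E}_{X\sim Q}[f(X)]\right|$. For $Q=\widehat P_Z$, which is given by a (possibly signed) density with respect to $\lambda$, $\mathbb{E}_{X\sim Q}[f(X)]$ means the integral of $f$ against that density. Truncated series estimator: for finite $Z\subseteq\mathcal{Z}$, $\widehat P_Z:=\sum_{z\in Z}\widehat P_z\phi_z$, where $\widehat P_z:=\frac1n\sum_{i=1}^n\phi_z(X_i)$ for each $z\in\mathcal{Z}$. Norms: $\|\phi_z\|_{L^\infty_P}$ is the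 $P$-essential supremum of $|\phi_z|$, and $\|\{u_z\}\|_r$ is the $\ell^r$ norm over the indicated index set.
   Formalization: If P has no square-integrable density, F_D is restricted to functions whose basis expansion also converges to them in L^1(P) (else false, e.g. for point masses); for p=1 the constant c_{p'} may be infinite (no finite one works); for 1/p+1/q>1 the last norm is the sup norm. *)

theory Defs
  imports "HOL-Probability.Probability"
begin

text \<open>
  Lebesgue measure on the Borel sets of the cube \<open>[0,1]^d\<close>. The dimension is a natural number
  rather than a type so that a constant can be required not to depend on it; points are
  extensional functions on \<open>{..<d}\<close> with values in \<open>[0,1]\<close>.
\<close>

definition cube :: "nat \<Rightarrow> (nat \<Rightarrow> real) measure" where
  "cube d = (\<Pi>\<^sub>M i\<in>{..<d}. restrict_space lborel {0..1})"

definition coeff :: "nat \<Rightarrow> ('z \<Rightarrow> (nat \<Rightarrow> real) \<Rightarrow> real) \<Rightarrow> ((nat \<Rightarrow> real) \<Rightarrow> real) \<Rightarrow> 'z \<Rightarrow> real" where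
  "coeff d \<phi> f z = (\<integral>x. f x * \<phi> z x \<partial>cube d)"

definition prob_coeff :: "('z \<Rightarrow> (nat \<Rightarrow> real) \<Rightarrow> real) \<Rightarrow> (nat \<Rightarrow> real) measure \<Rightarrow> 'z \<Rightarrow> real" where
  "prob_coeff \<phi> P z = (\<integral>x. \<phi> z x \<partial>P)"

definition square_integrable :: "nat \<Rightarrow> ((nat \<Rightarrow> real) \<Rightarrow> real) \<Rightarrow> bool" where
  "square_integrable d f \<longleftrightarrow>
     f \<in> borel_measurable (cube d) \<and> integrable (cube d) (\<lambda>x. (f x)\<^sup>2)"

definition orthonormal_basis :: "nat \<Rightarrow> 'z set \<Rightarrow> ('z \<Rightarrow> (nat \<Rightarrow> real) \<Rightarrow> real) \<Rightarrow> bool" where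
  "orthonormal_basis d I \<phi> \<longleftrightarrow>
     (\<forall>z\<in>I. square_integrable d (\<phi> z)) \<and>
     (\<forall>z\<in>I. \<forall>w\<in>I. (\<integral>x. \<phi> z x * \<phi> w x \<partial>cube d) = (if z = w then 1 else 0)) \<and>
     (\<forall>f. square_integrable d f \<longrightarrow>
        ((\<lambda>F. \<integral>x. (f x - (\<Sum>z\<in>F. coeff d \<phi> f z * \<phi> z x))\<^sup>2 \<partial>cube d) \<longlongrightarrow> 0)
          (finite_subsets_at_top I))"

definition epowr :: "ennreal \<Rightarrow> real \<Rightarrow> ennreal" where
  "epowr x r = (if x = \<infinity> then \<infinity> else ennreal (enn2real x powr r))"

text \<open>
  The \<open>\<ell>\<^sup>r\<close> norm of a family of absolute values, for \<open>0 < r \<le> \<infinity>\<close>; for \<open>r = \<infinity>\<close> it is the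
  supremum norm, which is \<open>0\<close> for the empty family.
\<close>

definition lnorm :: "ennreal \<Rightarrow> 'z set \<Rightarrow> ('z \<Rightarrow> ennreal) \<Rightarrow> ennreal" where
  "lnorm r A u =
     (if r = \<infinity> then (SUP z\<in>A. u z)
      else epowr (\<integral>\<^sup>+z. epowr (u z) (enn2real r) \<partial>count_space A) (1 / enn2real r))"

text \<open>
  For \<open>p = 1\<close> this is \<open>1 / 0 = \<infinity>\<close>. A bound with a finite constant cannot hold there: for
  large \<open>n\<close> the expected maximum of \<open>m\<close> empirical coefficients grows like \<open>sqrt (ln m / n)\<close>. The
  constant attached to the exponent \<open>\<infinity>\<close> is therefore allowed to be infinite.
\<close>

definition conj_exponent :: "real \<Rightarrow> ennreal" where
  "conj_exponent p = ennreal p / ennreal (p - 1)"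

text \<open>
  The exponent \<open>1 / (1 - 1/p - 1/q)\<close>. As \<open>ennreal\<close> maps negative reals to \<open>0\<close> and
  \<open>1 / 0 = \<infinity>\<close> in \<open>ennreal\<close>, it is \<open>\<infinity>\<close> whenever \<open>1/p + 1/q \<ge> 1\<close>.
\<close>

definition bias_exponent :: "real \<Rightarrow> real \<Rightarrow> ennreal" where
  "bias_exponent p q = 1 / ennreal (1 - 1/p - 1/q)"

text \<open>
  Nets are real-valued without sign restriction; powers and quotients are those of \<open>\<bar>a z\<bar>\<close>,
  which changes nothing for nonnegative nets.
\<close>

definition coeff_ellipse :: "'z set \<Rightarrow> real \<Rightarrow> ('z \<Rightarrow> real) \<Rightarrow> real \<Rightarrow> ('z \<Rightarrow> real) set" where
  "coeff_ellipse I p a L = {u. lnorm (ennreal p) I (\<lambda>z. ennreal (\<bar>a z\<bar> * \<bar>u z\<bar>)) \<le> ennreal L}"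

definition ellipse ::
  "nat \<Rightarrow> 'z set \<Rightarrow> ('z \<Rightarrow> (nat \<Rightarrow> real) \<Rightarrow> real) \<Rightarrow> real \<Rightarrow> ('z \<Rightarrow> real) \<Rightarrow> real
     \<Rightarrow> ((nat \<Rightarrow> real) \<Rightarrow> real) set" where
  "ellipse d I \<phi> p a L = {f. integrable (cube d) f \<and> coeff d \<phi> f \<in> coeff_ellipse I p a L}"

definition prob_ellipse ::
  "nat \<Rightarrow> 'z set \<Rightarrow> ('z \<Rightarrow> (nat \<Rightarrow> real) \<Rightarrow> real) \<Rightarrow> real \<Rightarrow> ('z \<Rightarrow> real) \<Rightarrow> real
     \<Rightarrow> (nat \<Rightarrow> real) measure set" where
  "prob_ellipse d I \<phi> q b L =
     {P. prob_space P \<and> sets P = sets (cube d) \<and> prob_coeff \<phi> P \<in> coeff_ellipse I q b L}"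

definition has_L2_density :: "nat \<Rightarrow> (nat \<Rightarrow> real) measure \<Rightarrow> bool" where
  "has_L2_density d P \<longleftrightarrow>
     (\<exists>\<rho>. square_integrable d \<rho> \<and> (\<forall>x. 0 \<le> \<rho> x) \<and> P = density (cube d) (\<lambda>x. ennreal (\<rho> x)))"

definition expansion_converges ::
  "nat \<Rightarrow> 'z set \<Rightarrow> ('z \<Rightarrow> (nat \<Rightarrow> real) \<Rightarrow> real) \<Rightarrow> (nat \<Rightarrow> real) measure
     \<Rightarrow> ((nat \<Rightarrow> real) \<Rightarrow> real) \<Rightarrow> bool" where
  "expansion_converges d I \<phi> P f \<longleftrightarrow>
     ((\<lambda>F. \<integral>x. \<bar>f x - (\<Sum>z\<in>F. coeff d \<phi> f z * \<phi> z x)\<bar> \<partial>P) \<longlongrightarrow> 0) (finite_subsets_at_top I)"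

text \<open>
  The bounded Borel functions in the ellipse, as they are tested against \<open>P\<close>. If \<open>P\<close> has a
  square-integrable density these are all of them. In general an ellipse, being defined through
  integrals with respect to Lebesgue measure, does not determine the expectations of its members
  under \<open>P\<close>: if \<open>N\<close> is a null set with \<open>P N > 0\<close>, every multiple of \<open>indicator N\<close> has vanishing
  coefficients, hence lies in every ellipse, and the adversarial loss would be infinite. So, for a
  \<open>P\<close> without such a density, a function in the ellipse counts as a discriminator if its basis
  expansion also represents it in \<open>L\<^sup>1(P)\<close>.
\<close>

definition discriminators ::
  "nat \<Rightarrow> 'z set \<Rightarrow> ('z \<Rightarrow> (nat \<Rightarrow> real) \<Rightarrow> real) \<Rightarrow> real \<Rightarrow> ('z \<Rightarrow> real) \<Rightarrow> real
     \<Rightarrow> (nat \<Rightarrow> real) measure \<Rightarrow> ((nat \<Rightarrow> real) \<Rightarrow> real) set" where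
  "discriminators d I \<phi> p a L P =
     {f \<in> ellipse d I \<phi> p a L.
        f \<in> borel_measurable (cube d) \<and> bounded (f ` space (cube d)) \<and>
        (has_L2_density d P \<or> expansion_converges d I \<phi> P f)}"

text \<open>
  Adversarial loss between \<open>P\<close> and the signed measure with Lebesgue density \<open>g\<close>.
\<close>

definition adv_loss ::
  "nat \<Rightarrow> ((nat \<Rightarrow> real) \<Rightarrow> real) set \<Rightarrow> (nat \<Rightarrow> real) measure \<Rightarrow> ((nat \<Rightarrow> real) \<Rightarrow> real)
     \<Rightarrow> ennreal" where
  "adv_loss d F P g = (SUP f\<in>F. ennreal \<bar>(\<integral>x. f x \<partial>P) - (\<integral>x. f x * g x \<partial>cube d)\<bar>)"

definition emp_coeff ::
  "('z \<Rightarrow> (nat \<Rightarrow> real) \<Rightarrow> real) \<Rightarrow> nat \<Rightarrow> (nat \<Rightarrow> nat \<Rightarrow> real) \<Rightarrow> 'z \<Rightarrow> real" where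
  "emp_coeff \<phi> n X z = (1 / real n) * (\<Sum>i<n. \<phi> z (X i))"

definition series_estimator ::
  "('z \<Rightarrow> (nat \<Rightarrow> real) \<Rightarrow> real) \<Rightarrow> 'z set \<Rightarrow> nat \<Rightarrow> (nat \<Rightarrow> nat \<Rightarrow> real) \<Rightarrow> (nat \<Rightarrow> real) \<Rightarrow> real" where
  "series_estimator \<phi> Z n X = (\<lambda>y. \<Sum>z\<in>Z. emp_coeff \<phi> n X z * \<phi> z y)"

end

theory Submission
  imports Defs
begin

text \<open>
  Testing a discriminator \<open>f\<close> against \<open>P\<close> is the limit of the finite sums \<open>\<Sum>z\<in>F. f\<^sub>z * P\<^sub>z\<close>; this is where
  a square-integrable density or convergence in \<open>L\<^sup>1(P)\<close> is needed. The sums outside \<open>Z\<close> are bounded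
  by Hoelder's inequality with the exponents \<open>p\<close>, \<open>q\<close> and \<open>1 / (1 - 1/p - 1/q)\<close>. Inside \<open>Z\<close> the
  error of an empirical coefficient is a centred mean of bounded variables; Hoeffding's lemma bounds
  its exponential moments and hence its \<open>p'\<close>-th moment, with constant \<open>4 * p'\<close>. Young's inequality,
  scaled by the target bound, replaces both Hoelder's and Jensen's inequality in passing from the
  moments to the expected supremum over \<open>f\<close>.
\<close>

section \<open>Young's and Hoelder's inequalities for finite sums, normalised to bounds of 1\<close>

text \<open>Two applications of the two-factor inequality: the first two factors are merged into the
  weighted geometric mean \<open>g\<close> with weights \<open>\<alpha> / s\<close> and
  \<open>\<beta> / s\<close>, and \<open>g\<close> is then paired with \<open>w\<close> at weights
  \<open>s\<close> and \<open>\<gamma>\<close>.\<close>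

lemma Youngs_inequality_3:
  fixes x y w :: real
  assumes "0 < \<alpha>" "0 < \<beta>" "0 < \<gamma>" "\<alpha> + \<beta> + \<gamma> = 1" "0 \<le> x" "0 \<le> y" "0 \<le> w"
  shows "x powr \<alpha> * y powr \<beta> * w powr \<gamma> \<le> \<alpha> * x + \<beta> * y + \<gamma> * w"
proof (cases "x = 0 \<or> y = 0 \<or> w = 0")
  case True
  then show ?thesis using assms by auto
next
  case False
  define s where "s = \<alpha> + \<beta>"
  have s: "0 < s" "s + \<gamma> = 1" using assms by (auto simp: s_def)
  define g where "g = x powr (\<alpha> / s) * y powr (\<beta> / s)"
  have g: "g \<le> \<alpha> / s * x + \<beta> / s * y"
    unfolding g_def
    by (rule Youngs_inequality_0)
       (use assms False s in \<open>auto simp: s_def simp flip: add_divide_distrib\<close>)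
  have "x powr \<alpha> * y powr \<beta> * w powr \<gamma> = g powr s * w powr \<gamma>"
    using s by (simp add: g_def powr_mult powr_powr)
  also have "\<dots> \<le> s * g + \<gamma> * w"
    by (rule Youngs_inequality_0) (use assms False s in \<open>auto simp: g_def\<close>)
  also have "s * g \<le> s * (\<alpha> / s * x + \<beta> / s * y)"
    using g s by (intro mult_left_mono) auto
  also have "\<dots> = \<alpha> * x + \<beta> * y" using s by (simp add: field_simps)
  finally show ?thesis by simp
qed

text \<open>Serves the range in which no third exponent is left over and the third factor is
  measured in the supremum norm. Dividing by \<open>s\<close> turns \<open>1/p\<close> and
  \<open>1/q\<close> into the conjugate weights \<open>1 / (p * s)\<close> and
  \<open>1 / (q * s)\<close>, as in the inclusion of an l^p ball into one with larger
  exponent.\<close>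

lemma Hoelder_sum_le_1:
  fixes x y :: "'a \<Rightarrow> real"
  assumes "finite F" "1 \<le> p" "1 \<le> q" "1 \<le> 1/p + 1/q"
    and nonneg: "\<And>z. z \<in> F \<Longrightarrow> 0 \<le> x z" "\<And>z. z \<in> F \<Longrightarrow> 0 \<le> y z"
    and x: "(\<Sum>z\<in>F. x z powr p) \<le> 1" and y: "(\<Sum>z\<in>F. y z powr q) \<le> 1"
  shows "(\<Sum>z\<in>F. x z * y z) \<le> 1"
proof -
  define s where "s = 1/p + 1/q"
  have s: "1 \<le> s" using assms by (simp add: s_def)
  have "1 / (p * s) + 1 / (q * s) = (1/p + 1/q) / s" by (simp add: add_divide_distrib)
  then have one: "1 / (p * s) + 1 / (q * s) = 1" using s unfolding s_def by simp
  have *: "x z * y z \<le> 1 / (p * s) * x z powr p + 1 / (q * s) * y z powr q" if z: "z \<in> F" for z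
  proof (cases "x z = 0 \<or> y z = 0")
    case True
    then show ?thesis using assms s by auto
  next
    case False
    then have pos: "0 < x z" "0 < y z" using nonneg[OF z] by auto
    have "x z powr p \<le> (\<Sum>z\<in>F. x z powr p)" "y z powr q \<le> (\<Sum>z\<in>F. y z powr q)"
      by (rule member_le_sum; use z assms in simp)+
    then have le1: "x z powr p \<le> 1" "y z powr q \<le> 1" using x y by linarith+
    have "x z * y z = (x z powr p) powr (1/p) * (y z powr q) powr (1/q)"
      using assms pos by (simp add: powr_powr)
    \<comment> \<open>Both powers are at most \<open>1\<close>, so the exponents may be shrunk until they sum to \<open>1\<close>.\<close>
    also have "\<dots> \<le> (x z powr p) powr (1 / (p * s)) * (y z powr q) powr (1 / (q * s))"
      using s assms pos le1
      by (intro mult_mono powr_mono') (auto simp: divide_simps mult_le_cancel_left1)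
    also have "\<dots> \<le> 1 / (p * s) * x z powr p + 1 / (q * s) * y z powr q"
      by (rule Youngs_inequality_0) (use one assms s pos in auto)
    finally show ?thesis .
  qed
  have "(\<Sum>z\<in>F. x z * y z) \<le> (\<Sum>z\<in>F. 1 / (p * s) * x z powr p + 1 / (q * s) * y z powr q)"
    by (intro sum_mono *)
  also have "\<dots> = 1 / (p * s) * (\<Sum>z\<in>F. x z powr p) + 1 / (q * s) * (\<Sum>z\<in>F. y z powr q)"
    by (simp only: sum.distrib sum_distrib_left)
  also have "\<dots> \<le> 1 / (p * s) * 1 + 1 / (q * s) * 1"
    using assms s x y by (intro add_mono mult_left_mono) auto
  finally show ?thesis using one by simp
qed

text \<open>Once all three power sums are at most 1, Hoelder's inequality is Young's inequality
  summed over \<open>F\<close>, because the weights \<open>1/p\<close>, \<open>1/q\<close>,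
  \<open>1/r\<close> add up to 1.\<close>

lemma Hoelder_sum_3_le_1:
  fixes x y w :: "'a \<Rightarrow> real"
  assumes "finite F" "0 < p" "0 < q" "0 < r" "1/p + 1/q + 1/r = 1"
    and nonneg: "\<And>z. z \<in> F \<Longrightarrow> 0 \<le> x z" "\<And>z. z \<in> F \<Longrightarrow> 0 \<le> y z" "\<And>z. z \<in> F \<Longrightarrow> 0 \<le> w z"
    and x: "(\<Sum>z\<in>F. x z powr p) \<le> 1" and y: "(\<Sum>z\<in>F. y z powr q) \<le> 1"
    and w: "(\<Sum>z\<in>F. w z powr r) \<le> 1"
  shows "(\<Sum>z\<in>F. x z * y z * w z) \<le> 1"
proof -
  have *: "x z * y z * w z \<le> 1/p * x z powr p + 1/q * y z powr q + 1/r * w z powr r"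
    if z: "z \<in> F" for z
    using Youngs_inequality_3[of "1/p" "1/q" "1/r" "x z powr p" "y z powr q" "w z powr r"]
      assms nonneg[OF z] by (simp add: powr_powr)
  have "(\<Sum>z\<in>F. x z * y z * w z)
      \<le> (\<Sum>z\<in>F. 1/p * x z powr p + 1/q * y z powr q + 1/r * w z powr r)"
    by (intro sum_mono *)
  also have "\<dots> = 1/p * (\<Sum>z\<in>F. x z powr p) + 1/q * (\<Sum>z\<in>F. y z powr q) + 1/r * (\<Sum>z\<in>F. w z powr r)"
    by (simp only: sum.distrib sum_distrib_left)
  also have "\<dots> \<le> 1/p * 1 + 1/q * 1 + 1/r * 1"
    using assms by (intro add_mono mult_left_mono) auto
  finally show ?thesis using assms by simp
qed

section \<open>Norms of families with values in \<open>ennreal\<close>\<close>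

lemma epowr_ennreal: "0 \<le> x \<Longrightarrow> epowr (ennreal x) r = ennreal (x powr r)"
  by (simp add: epowr_def)

text \<open>Disposes of vanishing weights: a positive numerator over \<open>0\<close> is infinite in
  \<open>ennreal\<close>, so one such index already makes the norm on the right-hand side
  infinite.\<close>

lemma lnorm_eq_top:
  assumes "z \<in> A" "u z = \<infinity>"
  shows "lnorm r A u = \<infinity>"
proof (cases "r = \<infinity>")
  case True
  have "u z \<le> (SUP z\<in>A. u z)" using assms by (intro SUP_upper)
  then show ?thesis using True assms by (simp add: lnorm_def top_unique)
next
  case False
  have "epowr (u z) (enn2real r) \<le> (\<integral>\<^sup>+z. epowr (u z) (enn2real r) \<partial>count_space A)"
    using assms(1) by (rule nn_integral_ge_point)
  then have "(\<integral>\<^sup>+z. epowr (u z) (enn2real r) \<partial>count_space A) = \<infinity>"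
    using assms(2) by (simp add: epowr_def top_unique)
  then show ?thesis using False by (simp add: lnorm_def epowr_def)
qed

lemma lnorm_finite_set:
  assumes "finite A" "0 < r" "\<And>z. z \<in> A \<Longrightarrow> 0 \<le> u z"
  shows "lnorm (ennreal r) A (\<lambda>z. ennreal (u z)) = ennreal ((\<Sum>z\<in>A. u z powr r) powr (1 / r))"
proof -
  have "(\<integral>\<^sup>+z. epowr (ennreal (u z)) r \<partial>count_space A) = (\<Sum>z\<in>A. epowr (ennreal (u z)) r)"
    using assms by (simp add: nn_integral_count_space_finite)
  also have "\<dots> = ennreal (\<Sum>z\<in>A. u z powr r)"
    using assms by (simp add: epowr_ennreal)
  finally show ?thesis
    using assms by (simp add: lnorm_def epowr_ennreal sum_nonneg)
qed

lemma lnorm_cong: "(\<And>z. z \<in> A \<Longrightarrow> u z = v z) \<Longrightarrow> lnorm r A u = lnorm r A v"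
  by (auto simp: lnorm_def cong: SUP_cong intro!: arg_cong2[where f=epowr] nn_integral_cong)

lemma epowr_mono: "x \<le> y \<Longrightarrow> 0 \<le> r \<Longrightarrow> epowr x r \<le> epowr y r"
  by (auto simp: epowr_def top_unique less_top intro!: ennreal_leI powr_mono2 enn2real_mono)

lemma lnorm_mono_set:
  assumes "A \<subseteq> B"
  shows "lnorm r A u \<le> lnorm r B u"
proof (cases "r = \<infinity>")
  case True
  then show ?thesis using assms by (simp add: lnorm_def SUP_subset_mono)
next
  case False
  let ?g = "\<lambda>z. epowr (u z) (enn2real r)"
  have "(\<integral>\<^sup>+z. ?g z \<partial>count_space A) = (\<integral>\<^sup>+z. ?g z * indicator A z \<partial>count_space A)"
    by (intro nn_integral_cong) simp
  also have "\<dots> = (\<integral>\<^sup>+z. ?g z * indicator A z \<partial>count_space B)"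
    using assms by (intro nn_integral_count_space_eq) auto
  also have "\<dots> \<le> (\<integral>\<^sup>+z. ?g z \<partial>count_space B)"
    by (intro nn_integral_mono) (simp split: split_indicator)
  finally have "(\<integral>\<^sup>+z. ?g z \<partial>count_space A) \<le> (\<integral>\<^sup>+z. ?g z \<partial>count_space B)" .
  then show ?thesis using False by (simp add: lnorm_def epowr_mono)
qed

text \<open>Brings a bound on the norm of a possibly infinite family into the form in which the
  Hoelder lemmas for finite sums take their hypotheses.\<close>

lemma lnorm_sum_powr_le_1:
  assumes le: "lnorm (ennreal r) A (\<lambda>z. ennreal (u z)) \<le> ennreal L"
    and "finite F" "F \<subseteq> A" "0 < r" "0 < L" "\<And>z. z \<in> A \<Longrightarrow> 0 \<le> u z"
  shows "(\<Sum>z\<in>F. (u z / L) powr r) \<le> 1"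
proof -
  have "ennreal ((\<Sum>z\<in>F. u z powr r) powr (1 / r)) = lnorm (ennreal r) F (\<lambda>z. ennreal (u z))"
    by (rule lnorm_finite_set[symmetric]) (use assms in auto)
  also have "\<dots> \<le> ennreal L"
    using lnorm_mono_set[OF assms(3)] le by (rule order_trans)
  finally have "(\<Sum>z\<in>F. u z powr r) powr (1 / r) \<le> L"
    using assms by (simp add: ennreal_le_iff)
  then have "((\<Sum>z\<in>F. u z powr r) powr (1 / r)) powr r \<le> L powr r"
    using assms by (intro powr_mono2) auto
  then have "(\<Sum>z\<in>F. u z powr r) \<le> L powr r"
    using assms by (simp add: powr_powr sum_nonneg)
  moreover have "(\<Sum>z\<in>F. (u z / L) powr r) = (\<Sum>z\<in>F. u z powr r) / L powr r"
    using assms by (subst sum_divide_distrib) (auto intro!: sum.cong simp: powr_divide)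
  ultimately show ?thesis using assms by simp
qed

section \<open>Pairing the elements of two ellipses\<close>

lemma coeff_ellipse_sum_le_1:
  assumes "u \<in> coeff_ellipse I p a L" "finite F" "F \<subseteq> I" "0 < p" "0 < L"
  shows "(\<Sum>z\<in>F. (\<bar>a z\<bar> * \<bar>u z\<bar> / L) powr p) \<le> 1"
  using assms by (intro lnorm_sum_powr_le_1[where A = I]) (auto simp: coeff_ellipse_def)

text \<open>With the normalised weighted coefficients \<open>x\<close> and \<open>y\<close> and with
  \<open>w z = 1 / \<bar>a z * b z\<bar>\<close>, each term is
  \<open>A * B * (x z * y z * w z)\<close>. The ellipses bound the power sums of \<open>x\<close>
  and \<open>y\<close> by 1, and the exponent left for \<open>w\<close> is
  \<open>bias_exponent p q\<close>: two-factor Hoelder and a supremum if it is infinite,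
  three-factor Hoelder otherwise.\<close>

lemma coeff_ellipse_pairing:
  assumes u: "u \<in> coeff_ellipse I p a A" and v: "v \<in> coeff_ellipse I q b B"
    and "1 \<le> p" "1 \<le> q" "0 < A" "0 < B" "finite F" "F \<subseteq> J" "J \<subseteq> I"
  shows "ennreal (\<Sum>z\<in>F. \<bar>u z * v z\<bar>)
    \<le> ennreal (A * B) * lnorm (bias_exponent p q) J (\<lambda>z. 1 / ennreal \<bar>a z * b z\<bar>)"
    (is "_ \<le> _ * ?N")
\<comment> \<open>An infinite \<open>?N\<close> makes the right-hand side infinite, as
  \<open>A * B\<close> is positive. In the remaining case no weight in \<open>J\<close> vanishes,
  and a point of the nonempty \<open>F\<close> shows \<open>0 < N\<close> when the exponent is
  finite, so that \<open>w\<close> can be divided by \<open>N\<close>.\<close>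
proof (cases "?N = \<infinity> \<or> F = {}")
  case True
  then show ?thesis using assms by (auto simp: ennreal_mult_top)
next
  case False
  have ab: "a z * b z \<noteq> 0" if "z \<in> J" for z
    using False lnorm_eq_top[of z J "\<lambda>z. 1 / ennreal \<bar>a z * b z\<bar>"] that
    by (auto simp: ennreal_divide_zero)
  define w where "w z = 1 / \<bar>a z * b z\<bar>" for z
  have N: "?N = lnorm (bias_exponent p q) J (\<lambda>z. ennreal (w z))"
    using ab by (intro lnorm_cong) (simp add: w_def divide_ennreal flip: ennreal_1)
  obtain N where N': "?N = ennreal N" "0 \<le> N" using False by (cases "?N") auto
  define x where "x z = \<bar>a z\<bar> * \<bar>u z\<bar> / A" for z
  define y where "y z = \<bar>b z\<bar> * \<bar>v z\<bar> / B" for z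
  have x: "(\<Sum>z\<in>F. x z powr p) \<le> 1" and y: "(\<Sum>z\<in>F. y z powr q) \<le> 1"
    unfolding x_def y_def using assms by (auto intro!: coeff_ellipse_sum_le_1)
  have xy: "0 \<le> x z" "0 \<le> y z" "0 \<le> w z" for z using assms by (auto simp: x_def y_def w_def)
  have eq: "\<bar>u z * v z\<bar> = A * B * (x z * y z * w z)" if "z \<in> F" for z
    using ab[of z] that assms by (auto simp: x_def y_def w_def abs_mult)
  have "(\<Sum>z\<in>F. x z * y z * w z) \<le> N"
  proof (cases "1 \<le> 1/p + 1/q")
    case True
    then have "bias_exponent p q = \<infinity>" by (simp add: bias_exponent_def ennreal_neg)
    then have w: "w z \<le> N" if "z \<in> F" for z
      using SUP_upper[of z J "\<lambda>z. ennreal (w z)"] N N' that assms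
      by (auto simp: lnorm_def)
    have "(\<Sum>z\<in>F. x z * y z * w z) \<le> (\<Sum>z\<in>F. x z * y z * N)"
      using w xy by (intro sum_mono mult_left_mono) auto
    also have "\<dots> = (\<Sum>z\<in>F. x z * y z) * N" by (simp add: sum_distrib_right)
    also have "\<dots> \<le> 1 * N"
      using True assms x y xy N' by (intro mult_right_mono Hoelder_sum_le_1[where p=p and q=q]) auto
    finally show ?thesis by simp
  next
    case False2: False
    define r where "r = 1 / (1 - 1/p - 1/q)"
    have r: "0 < r" "1/p + 1/q + 1/r = 1" using False2 by (auto simp: r_def)
    have be: "bias_exponent p q = ennreal r"
      using False2 by (simp add: bias_exponent_def r_def divide_ennreal flip: ennreal_1)
    have "0 < N"
    proof -
      obtain z where z: "z \<in> F" using False by auto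
      have "lnorm (ennreal r) {z} (\<lambda>z. ennreal (w z)) \<le> lnorm (ennreal r) J (\<lambda>z. ennreal (w z))"
        using z assms by (intro lnorm_mono_set) auto
      also have "\<dots> = ennreal N" using N N' be by simp
      finally have "w z \<le> N"
        using r xy(3)[of z] N' by (subst (asm) lnorm_finite_set) (auto simp: powr_powr)
      moreover have "0 < w z" using ab[of z] z assms by (auto simp: w_def)
      ultimately show ?thesis by simp
    qed
    have "(\<Sum>z\<in>F. x z * y z * (w z / N)) \<le> 1"
    proof (rule Hoelder_sum_3_le_1[where p=p and q=q and r=r])
      show "(\<Sum>z\<in>F. (w z / N) powr r) \<le> 1"
        by (rule lnorm_sum_powr_le_1[where A=J]) (use assms r xy N N' be \<open>0 < N\<close> in auto)
    qed (use assms r x y xy \<open>0 < N\<close> in auto)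
    then show ?thesis using \<open>0 < N\<close> by (simp flip: sum_divide_distrib)
  qed
  then have "A * B * (\<Sum>z\<in>F. x z * y z * w z) \<le> A * B * N"
    using assms by (intro mult_left_mono) auto
  then have "(\<Sum>z\<in>F. \<bar>u z * v z\<bar>) \<le> A * B * N"
    using eq by (simp add: sum_distrib_left)
  then show ?thesis
    using assms N' by (auto simp flip: ennreal_mult intro!: ennreal_leI)
qed

section \<open>Moments of the empirical mean of a bounded variable\<close>

text \<open>Raise \<open>t \<le> exp t\<close> at \<open>t = \<bar>u\<bar> / r\<close> to the power
  \<open>r\<close>. Two exponentials replace \<open>exp \<bar>u\<bar>\<close> so that each can be
  estimated by Hoeffding's lemma on its own.\<close>

lemma powr_le_exp:
  fixes u r :: real
  assumes "0 < r"
  shows "\<bar>u\<bar> powr r \<le> r powr r * (exp u + exp (- u))"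
proof -
  have "\<bar>u\<bar> / r \<le> exp (\<bar>u\<bar> / r)"
    using exp_ge_add_one_self[of "\<bar>u\<bar> / r"] by linarith
  then have "(\<bar>u\<bar> / r) powr r \<le> exp (\<bar>u\<bar> / r) powr r"
    using assms by (intro powr_mono2) auto
  also have "\<dots> = exp \<bar>u\<bar>" using assms by (simp add: exp_powr_real)
  also have "\<dots> \<le> exp u + exp (- u)" by (simp add: abs_if)
  finally show ?thesis using assms by (simp add: powr_divide field_simps)
qed

context prob_space
begin

text \<open>Independence factorises the exponential moment, and Hoeffding's lemma bounds each factor
  for a variable with values in an interval of length \<open>2 * B\<close>. The scale
  \<open>t = 1 / (B * sqrt n)\<close> is chosen so that the \<open>n\<close> exponents add up to
  \<open>1/2\<close>, whatever \<open>n\<close> and \<open>B\<close> are.\<close>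

lemma nn_integral_exp_sum_deviation_le:
  fixes f :: "'a \<Rightarrow> real"
  assumes f [measurable]: "f \<in> borel_measurable M" and bound: "AE x in M. \<bar>f x\<bar> \<le> B"
    and B: "0 < B" and n: "0 < n"
  shows "(\<integral>\<^sup>+X. ennreal (exp ((\<Sum>i<n. f (X i) - expectation f) / (B * sqrt (real n))))
      \<partial>(\<Pi>\<^sub>M i\<in>{..<n}. M)) \<le> ennreal (exp (1/2))"
proof -
  interpret PP: product_prob_space "\<lambda>_::nat. M" "{..<n}"
    by unfold_locales
  interpret interval_bounded_random_variable M f "- B" B
    by unfold_locales (use bound in \<open>auto elim!: eventually_mono\<close>)
  define t where "t = 1 / (B * sqrt (real n))"
  have t: "0 < t" using B n by (simp add: t_def)
  have "(\<integral>\<^sup>+X. ennreal (exp ((\<Sum>i<n. f (X i) - expectation f) / (B * sqrt (real n))))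
        \<partial>(\<Pi>\<^sub>M i\<in>{..<n}. M))
      = (\<integral>\<^sup>+X. (\<Prod>i<n. ennreal (exp (t * (f (X i) - expectation f)))) \<partial>(\<Pi>\<^sub>M i\<in>{..<n}. M))"
    by (intro nn_integral_cong)
       (simp add: prod_ennreal t_def sum_divide_distrib flip: exp_sum)
  also have "\<dots> = (\<Prod>i<n. (\<integral>\<^sup>+x. ennreal (exp (t * (f x - expectation f))) \<partial>M))"
    by (rule PP.product_nn_integral_prod) auto
  also have "\<dots> \<le> (\<Prod>i<n. ennreal (exp (t\<^sup>2 * (B - (- B))\<^sup>2 / 8)))"
    by (intro prod_mono_ennreal Hoeffdings_lemma_nn_integral t)
  also have "\<dots> = ennreal (exp (real n * (t\<^sup>2 * (B - (- B))\<^sup>2 / 8)))"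
    by (simp add: ennreal_power flip: exp_of_nat_mult)
  also have "real n * (t\<^sup>2 * (B - (- B))\<^sup>2 / 8) = 1/2"
    using B n by (simp add: t_def power_divide power_mult_distrib field_simps power2_eq_square)
  finally show ?thesis .
qed

text \<open>The deviation is \<open>B / sqrt n\<close> times \<open>T\<close>, up to sign. Both
  \<open>T\<close> and \<open>- T\<close> have exponential moment at most \<open>exp (1/2)\<close>,
  the latter by passing to \<open>- f\<close>, and \<open>powr_le_exp\<close> converts this into a
  moment of order \<open>r\<close> at the price of the factor \<open>r powr r\<close>.\<close>

lemma nn_integral_mean_deviation_powr_le:
  fixes f :: "'a \<Rightarrow> real"
  assumes f [measurable]: "f \<in> borel_measurable M" and bound: "AE x in M. \<bar>f x\<bar> \<le> B"
    and B: "0 < B" and n: "0 < n" and r: "1 \<le> r"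
  shows "(\<integral>\<^sup>+X. ennreal (\<bar>expectation f - 1 / real n * (\<Sum>i<n. f (X i))\<bar> powr r)
      \<partial>(\<Pi>\<^sub>M i\<in>{..<n}. M)) \<le> ennreal ((4 * r * B / sqrt (real n)) powr r)"
proof -
  define T where "T X = (\<Sum>i<n. f (X i) - expectation f) / (B * sqrt (real n))" for X :: "nat \<Rightarrow> 'a"
  have T [measurable]: "T \<in> borel_measurable (\<Pi>\<^sub>M i\<in>{..<n}. M)"
    unfolding T_def by measurable
  define K where "K = (B * r / sqrt (real n)) powr r"
  have "(\<integral>\<^sup>+X. ennreal (exp (T X)) \<partial>(\<Pi>\<^sub>M i\<in>{..<n}. M)) \<le> ennreal (exp (1/2))"
    unfolding T_def by (rule nn_integral_exp_sum_deviation_le) (use assms in auto)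
  moreover have "(\<integral>\<^sup>+X. ennreal (exp (- T X)) \<partial>(\<Pi>\<^sub>M i\<in>{..<n}. M)) \<le> ennreal (exp (1/2))"
  proof -
    have "- T X = (\<Sum>i<n. - f (X i) - expectation (\<lambda>x. - f x)) / (B * sqrt (real n))" for X
      unfolding T_def by (simp add: sum_subtractf minus_divide_left sum_negf)
    then show ?thesis
      using nn_integral_exp_sum_deviation_le[of "\<lambda>x. - f x" B n] assms by simp
  qed
  ultimately have E: "(\<integral>\<^sup>+X. ennreal (exp (T X)) + ennreal (exp (- T X)) \<partial>(\<Pi>\<^sub>M i\<in>{..<n}. M))
      \<le> ennreal (exp (1/2)) + ennreal (exp (1/2))"
    by (subst nn_integral_add) (auto intro!: add_mono)
  have *: "\<bar>expectation f - 1 / real n * (\<Sum>i<n. f (X i))\<bar> powr r \<le> K * (exp (T X) + exp (- T X))" for X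
  proof -
    have "expectation f - 1 / real n * (\<Sum>i<n. f (X i)) = - (B / sqrt (real n)) * T X"
      using B n by (simp add: T_def sum_subtractf field_simps)
    then have "\<bar>expectation f - 1 / real n * (\<Sum>i<n. f (X i))\<bar> powr r
        = (B / sqrt (real n)) powr r * \<bar>T X\<bar> powr r"
      using B n by (simp add: abs_mult powr_mult powr_divide)
    also have "\<dots> \<le> (B / sqrt (real n)) powr r * (r powr r * (exp (T X) + exp (- T X)))"
      using powr_le_exp[of r "T X"] r by (intro mult_left_mono) auto
    also have "\<dots> = K * (exp (T X) + exp (- T X))"
      using B n r by (simp add: K_def powr_mult powr_divide)
    finally show ?thesis .
  qed
  have "(\<integral>\<^sup>+X. ennreal (\<bar>expectation f - 1 / real n * (\<Sum>i<n. f (X i))\<bar> powr r) \<partial>(\<Pi>\<^sub>M i\<in>{..<n}. M))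
      \<le> (\<integral>\<^sup>+X. ennreal K * (ennreal (exp (T X)) + ennreal (exp (- T X))) \<partial>(\<Pi>\<^sub>M i\<in>{..<n}. M))"
    using * by (intro nn_integral_mono)
       (simp add: K_def ennreal_leI flip: ennreal_plus ennreal_mult)
  also have "\<dots> \<le> ennreal K * (ennreal (exp (1/2)) + ennreal (exp (1/2)))"
    by (subst nn_integral_cmult) (auto intro!: mult_left_mono E)
  also have "\<dots> = ennreal (K * (2 * exp (1/2)))"
    by (simp add: K_def flip: ennreal_plus ennreal_mult)
  \<comment> \<open>Origin of the 4 in \<open>4 * r\<close>:
    \<open>2 * exp (1/2) \<le> 4 \<le> 4 powr r\<close> as \<open>1 \<le> r\<close>, which lets the
    factor be absorbed into the base of the power.\<close>
  also have "\<dots> \<le> ennreal (K * 4 powr r)"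
  proof (intro ennreal_leI mult_left_mono)
    have "(4::real) powr 1 \<le> 4 powr r" using r by (intro powr_mono) auto
    then show "2 * exp (1/2 :: real) \<le> 4 powr r" using exp_half_le2 by simp
  qed (simp add: K_def)
  also have "K * 4 powr r = (4 * r * B / sqrt (real n)) powr r"
    using B r by (simp add: K_def powr_mult powr_divide)
  finally show ?thesis .
qed

end

section \<open>Expectations of discriminators through their basis expansions\<close>

lemma prob_space_cube: "prob_space (cube d)"
  unfolding cube_def by (intro prob_space_PiM prob_space_restrict_space) auto

lemma (in finite_measure) integrable_bounded_image:
  fixes g :: "'a \<Rightarrow> real"
  assumes "g \<in> borel_measurable M" "bounded (g ` space M)"
  shows "integrable M g"
proof -
  obtain B where "\<forall>x\<in>space M. norm (g x) \<le> B"
    using assms(2) by (auto simp: bounded_iff)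
  then show ?thesis
    using assms(1) by (intro integrable_const_bound[where B=B]) auto
qed

lemma bounded_mult_image:
  fixes f g :: "'a \<Rightarrow> real"
  assumes "bounded (f ` S)" "bounded (g ` S)"
  shows "bounded ((\<lambda>x. f x * g x) ` S)"
proof -
  obtain A B where "\<forall>x\<in>S. norm (f x) \<le> A" "\<forall>x\<in>S. norm (g x) \<le> B"
    using assms by (auto simp: bounded_iff)
  then have "\<forall>x\<in>S. norm (f x * g x) \<le> A * B"
    by (auto simp: abs_mult intro!: mult_mono intro: order_trans[OF abs_ge_zero])
  then show ?thesis by (auto simp: bounded_iff)
qed

lemma bounded_sum_image:
  fixes \<phi> :: "'z \<Rightarrow> 'a \<Rightarrow> real"
  assumes "finite F" "\<And>z. z \<in> F \<Longrightarrow> bounded (\<phi> z ` S)"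
  shows "bounded ((\<lambda>x. \<Sum>z\<in>F. c z * \<phi> z x) ` S)"
  using assms
proof (induction F rule: finite_induct)
  case empty
  have "(\<lambda>x::'a. 0::real) ` S \<subseteq> {0}" by auto
  then show ?case using bounded_subset[of "{0::real}"] by simp
next
  case (insert z F)
  have "bounded ((\<lambda>x. c z) ` S)" by (rule bounded_subset[of "{c z}"]) auto
  then show ?case
    using insert by (auto intro!: bounded_plus_comp bounded_mult_image)
qed

text \<open>A bounded \<open>f\<close> is square-integrable on the cube, so its expansion converges
  there in the L^2 sense, and a square-integrable density carries this over to L^1(P).
  Cauchy-Schwarz enters as \<open>\<rho> * \<bar>h\<bar> \<le> h\<^sup>2 / (2 * s) + s *
  \<rho>\<^sup>2 / 2\<close> with a free parameter \<open>s\<close>.\<close>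

lemma expansion_converges_of_L2_density:
  assumes basis: "orthonormal_basis d I \<phi>"
    and \<phi>: "\<And>z. z \<in> I \<Longrightarrow> bounded (\<phi> z ` space (cube d))"
    and f: "f \<in> borel_measurable (cube d)" "bounded (f ` space (cube d))"
    and P: "has_L2_density d P"
  shows "expansion_converges d I \<phi> P f"
proof -
  interpret prob_space "cube d" by (rule prob_space_cube)
  note f(1) [measurable]
  obtain \<rho> where \<rho>: "square_integrable d \<rho>" "\<And>x. 0 \<le> \<rho> x"
      and P_eq: "P = density (cube d) (\<lambda>x. ennreal (\<rho> x))"
    using P by (auto simp: has_L2_density_def)
  have [measurable]: "\<rho> \<in> borel_measurable (cube d)" and \<rho>2: "integrable (cube d) (\<lambda>x. (\<rho> x)\<^sup>2)"
    using \<rho> by (auto simp: square_integrable_def)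
  have \<phi>_meas: "\<phi> z \<in> borel_measurable (cube d)" if "z \<in> I" for z
    using basis that by (auto simp: orthonormal_basis_def square_integrable_def)
  define h where "h F x = f x - (\<Sum>z\<in>F. coeff d \<phi> f z * \<phi> z x)" for F x
  define B where "B = (\<integral>x. (\<rho> x)\<^sup>2 \<partial>cube d)"
  have B: "0 \<le> B" by (simp add: B_def)
  have "square_integrable d f"
    using f by (auto simp: square_integrable_def power2_eq_square
        intro!: integrable_bounded_image bounded_mult_image)
  then have lim: "((\<lambda>F. \<integral>x. (h F x)\<^sup>2 \<partial>cube d) \<longlongrightarrow> 0) (finite_subsets_at_top I)"
    using basis by (simp add: orthonormal_basis_def h_def)
  have le: "(\<integral>x. \<bar>h F x\<bar> \<partial>P) \<le> (\<integral>x. (h F x)\<^sup>2 \<partial>cube d) / (2 * s) + s * B / 2"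
    if F: "finite F" "F \<subseteq> I" and s: "0 < s" for F s
  proof -
    have hm [measurable]: "h F \<in> borel_measurable (cube d)"
      unfolding h_def using F \<phi>_meas by (intro borel_measurable_diff borel_measurable_sum) auto
    have h2: "integrable (cube d) (\<lambda>x. (h F x)\<^sup>2)"
      unfolding power2_eq_square using F f \<phi>
      by (intro integrable_bounded_image bounded_mult_image borel_measurable_times hm)
         (auto simp: h_def intro!: bounded_minus_comp bounded_sum_image)
    have *: "\<rho> x * \<bar>h F x\<bar> \<le> (h F x)\<^sup>2 / (2 * s) + s * (\<rho> x)\<^sup>2 / 2" for x
    proof -
      have "0 \<le> (\<bar>h F x\<bar> - s * \<rho> x)\<^sup>2" by simp
      then have "2 * s * (\<rho> x * \<bar>h F x\<bar>) \<le> (h F x)\<^sup>2 + s * (s * (\<rho> x)\<^sup>2)"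
        by (simp add: power2_diff power_mult_distrib power2_eq_square algebra_simps)
      then show ?thesis using s by (simp add: field_simps)
    qed
    have int: "integrable (cube d) (\<lambda>x. (h F x)\<^sup>2 / (2 * s) + s * (\<rho> x)\<^sup>2 / 2)"
      using h2 \<rho>2 by auto
    have "(\<integral>x. \<bar>h F x\<bar> \<partial>P) = (\<integral>x. \<rho> x * \<bar>h F x\<bar> \<partial>cube d)"
      unfolding P_eq using \<rho> by (subst integral_real_density) auto
    also have "\<dots> \<le> (\<integral>x. (h F x)\<^sup>2 / (2 * s) + s * (\<rho> x)\<^sup>2 / 2 \<partial>cube d)"
    proof (rule integral_mono)
      show "integrable (cube d) (\<lambda>x. \<rho> x * \<bar>h F x\<bar>)"
        by (rule Bochner_Integration.integrable_bound[OF int])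
           (use * \<rho> in \<open>auto simp: abs_mult intro!: AE_I2 order_trans[OF _ abs_ge_self]\<close>)
    qed (use int * in auto)
    also have "\<dots> = (\<integral>x. (h F x)\<^sup>2 \<partial>cube d) / (2 * s) + s * B / 2"
      using h2 \<rho>2 by (simp add: B_def)
    finally show ?thesis .
  qed
  have "((\<lambda>F. \<integral>x. \<bar>h F x\<bar> \<partial>P) \<longlongrightarrow> 0) (finite_subsets_at_top I)"
  proof (rule tendstoI)
    fix e :: real assume e: "0 < e"
    \<comment> \<open>Makes \<open>s * B / 2\<close> at most \<open>e / 2\<close>, while the other
      term is eventually below \<open>e / 2\<close>; adding 1 keeps the denominator positive when
      \<open>B = 0\<close>.\<close>
    define s where "s = e / (B + 1)"
    have s: "0 < s" "s * B \<le> e" using e B by (auto simp: s_def field_simps)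
    have "\<forall>\<^sub>F F in finite_subsets_at_top I. (\<integral>x. (h F x)\<^sup>2 \<partial>cube d) < s * e"
      using order_tendstoD(2)[OF lim, of "s * e"] s e by simp
    moreover have "\<forall>\<^sub>F F in finite_subsets_at_top I. finite F \<and> F \<subseteq> I"
      by (rule eventually_finite_subsets_at_top_weakI) auto
    ultimately show "\<forall>\<^sub>F F in finite_subsets_at_top I. dist (\<integral>x. \<bar>h F x\<bar> \<partial>P) 0 < e"
    proof eventually_elim
      case (elim F)
      have "(\<integral>x. (h F x)\<^sup>2 \<partial>cube d) / (2 * s) < e / 2"
        using elim s by (simp add: field_simps)
      then have "(\<integral>x. \<bar>h F x\<bar> \<partial>P) < e"
        using le[of F s] elim s by linarith
      moreover have "0 \<le> (\<integral>x. \<bar>h F x\<bar> \<partial>P)" by simp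
      ultimately show ?case by simp
    qed
  qed
  then show ?thesis by (simp add: expansion_converges_def h_def)
qed

text \<open>The distance of a finite sum from the expectation is the modulus of the
  \<open>P\<close>-integral of the remainder of the expansion, hence at most its L^1(P) norm. That
  norm tends to 0 under either alternative in the definition of
  \<open>discriminators\<close>.\<close>

lemma discriminator_expectation_limit:
  assumes basis: "orthonormal_basis d I \<phi>"
    and \<phi>: "\<And>z. z \<in> I \<Longrightarrow> bounded (\<phi> z ` space (cube d))"
    and P: "prob_space P" "sets P = sets (cube d)"
    and f: "f \<in> discriminators d I \<phi> p a L P"
  shows "((\<lambda>F. \<Sum>z\<in>F. coeff d \<phi> f z * prob_coeff \<phi> P z) \<longlongrightarrow> (\<integral>x. f x \<partial>P)) (finite_subsets_at_top I)"
proof -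
  interpret prob_space P by fact
  have space_eq: "space P = space (cube d)" using P(2) by (rule sets_eq_imp_space_eq)
  have meas_eq: "borel_measurable P = borel_measurable (cube d)"
    using P by (intro measurable_cong_sets) auto
  have f': "f \<in> borel_measurable (cube d)" "bounded (f ` space (cube d))"
    using f by (auto simp: discriminators_def)
  have lim: "((\<lambda>F. \<integral>x. \<bar>f x - (\<Sum>z\<in>F. coeff d \<phi> f z * \<phi> z x)\<bar> \<partial>P) \<longlongrightarrow> 0) (finite_subsets_at_top I)"
    using f expansion_converges_of_L2_density[OF basis \<phi> f']
    by (auto simp: discriminators_def expansion_converges_def)
  have int_f: "integrable P f"
    using f' by (intro integrable_bounded_image) (auto simp: meas_eq space_eq)
  have int_\<phi>: "integrable P (\<phi> z)" if "z \<in> I" for z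
    using basis that \<phi>
    by (intro integrable_bounded_image)
       (auto simp: meas_eq space_eq orthonormal_basis_def square_integrable_def)
  have "norm ((\<Sum>z\<in>F. coeff d \<phi> f z * prob_coeff \<phi> P z) - (\<integral>x. f x \<partial>P))
      \<le> (\<integral>x. \<bar>f x - (\<Sum>z\<in>F. coeff d \<phi> f z * \<phi> z x)\<bar> \<partial>P)" if F: "finite F" "F \<subseteq> I" for F
  proof -
    have int: "integrable P (\<lambda>x. \<Sum>z\<in>F. coeff d \<phi> f z * \<phi> z x)"
      by (intro Bochner_Integration.integrable_sum integrable_mult_right) (use F int_\<phi> in auto)
    have "(\<integral>x. f x - (\<Sum>z\<in>F. coeff d \<phi> f z * \<phi> z x) \<partial>P)
        = (\<integral>x. f x \<partial>P) - (\<Sum>z\<in>F. coeff d \<phi> f z * prob_coeff \<phi> P z)"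
      using F int_f int_\<phi> int
      by (subst Bochner_Integration.integral_diff) (auto simp: prob_coeff_def subset_iff)
    then show ?thesis
      using integral_norm_bound[of P "\<lambda>x. f x - (\<Sum>z\<in>F. coeff d \<phi> f z * \<phi> z x)"]
      by (simp add: abs_minus_commute)
  qed
  then have "\<forall>\<^sub>F F in finite_subsets_at_top I.
      norm ((\<Sum>z\<in>F. coeff d \<phi> f z * prob_coeff \<phi> P z) - (\<integral>x. f x \<partial>P))
      \<le> (\<integral>x. \<bar>f x - (\<Sum>z\<in>F. coeff d \<phi> f z * \<phi> z x)\<bar> \<partial>P)"
    by (rule eventually_finite_subsets_at_top_weakI)
  from Lim_null_comparison[OF this lim] show ?thesis
    by (rule Lim_null[THEN iffD2])
qed

section \<open>Truncation bias, and the loss for fixed observations\<close>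

text \<open>For finite \<open>F\<close> containing \<open>Z\<close>, the difference of the sums over
  \<open>F\<close> and \<open>Z\<close> is a pairing over \<open>F - Z\<close>, whose bound does not
  depend on \<open>F\<close>. Such \<open>F\<close> are eventually reached along the net, so the
  bound passes to the limit.\<close>

lemma discriminator_bias_le:
  assumes basis: "orthonormal_basis d I \<phi>"
    and \<phi>: "\<And>z. z \<in> I \<Longrightarrow> bounded (\<phi> z ` space (cube d))"
    and P: "P \<in> prob_ellipse d I \<phi> q b L\<^sub>G"
    and f: "f \<in> discriminators d I \<phi> p a L\<^sub>D P"
    and "1 \<le> p" "1 \<le> q" "0 < L\<^sub>D" "0 < L\<^sub>G" "finite Z" "Z \<subseteq> I"
  shows "ennreal \<bar>(\<integral>x. f x \<partial>P) - (\<Sum>z\<in>Z. coeff d \<phi> f z * prob_coeff \<phi> P z)\<bar>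
    \<le> ennreal (L\<^sub>D * L\<^sub>G) * lnorm (bias_exponent p q) (I - Z) (\<lambda>z. 1 / ennreal \<bar>a z * b z\<bar>)"
    (is "_ \<le> ?R")
proof -
  let ?t = "\<lambda>z. coeff d \<phi> f z * prob_coeff \<phi> P z"
  have "((\<lambda>F. sum ?t F) \<longlongrightarrow> (\<integral>x. f x \<partial>P)) (finite_subsets_at_top I)"
    using P by (intro discriminator_expectation_limit[OF basis \<phi> _ _ f]) (auto simp: prob_ellipse_def)
  then have lim: "((\<lambda>F. ennreal \<bar>sum ?t F - sum ?t Z\<bar>) \<longlongrightarrow> ennreal \<bar>(\<integral>x. f x \<partial>P) - sum ?t Z\<bar>)
      (finite_subsets_at_top I)"
    by (intro tendsto_intros)
  have "ennreal \<bar>sum ?t F - sum ?t Z\<bar> \<le> ?R" if F: "finite F" "Z \<subseteq> F" "F \<subseteq> I" for F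
  proof -
    have "\<bar>sum ?t F - sum ?t Z\<bar> = \<bar>sum ?t (F - Z)\<bar>"
      using F assms by (simp add: sum_diff)
    also have "\<dots> \<le> (\<Sum>z\<in>F - Z. \<bar>?t z\<bar>)" by (rule sum_abs)
    finally have "ennreal \<bar>sum ?t F - sum ?t Z\<bar> \<le> ennreal (\<Sum>z\<in>F - Z. \<bar>?t z\<bar>)"
      by (rule ennreal_leI)
    also have "\<dots> \<le> ?R"
      by (rule coeff_ellipse_pairing[where I = I])
         (use assms F in \<open>auto simp: prob_ellipse_def discriminators_def ellipse_def\<close>)
    finally show ?thesis .
  qed
  then have "\<forall>\<^sub>F F in finite_subsets_at_top I. ennreal \<bar>sum ?t F - sum ?t Z\<bar> \<le> ?R"
    using assms by (auto simp: eventually_finite_subsets_at_top)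
  then show ?thesis
    by (rule tendsto_upperbound[OF lim]) simp
qed

text \<open>Inserting the sum of \<open>coeff d \<phi> f z * prob_coeff \<phi> P z\<close> over
  \<open>Z\<close> splits the error into a stochastic part and the bias. \<open>V\<close> has to
  bound the former for all discriminators at once, as the loss is their supremum.\<close>

lemma adv_loss_series_estimator_le:
  assumes basis: "orthonormal_basis d I \<phi>"
    and \<phi>: "\<And>z. z \<in> I \<Longrightarrow> bounded (\<phi> z ` space (cube d))"
    and P: "P \<in> prob_ellipse d I \<phi> q b L\<^sub>G"
    and "1 \<le> p" "1 \<le> q" "0 < L\<^sub>D" "0 < L\<^sub>G" "finite Z" "Z \<subseteq> I"
    and V: "\<And>f. f \<in> discriminators d I \<phi> p a L\<^sub>D P \<Longrightarrow>
      (\<Sum>z\<in>Z. \<bar>coeff d \<phi> f z\<bar> * \<bar>prob_coeff \<phi> P z - emp_coeff \<phi> n X z\<bar>) \<le> V"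
  shows "adv_loss d (discriminators d I \<phi> p a L\<^sub>D P) P (series_estimator \<phi> Z n X)
    \<le> ennreal V + ennreal (L\<^sub>D * L\<^sub>G)
        * lnorm (bias_exponent p q) (I - Z) (\<lambda>z. 1 / ennreal \<bar>a z * b z\<bar>)"
  unfolding adv_loss_def
proof (rule SUP_least)
  fix f assume f: "f \<in> discriminators d I \<phi> p a L\<^sub>D P"
  interpret prob_space "cube d" by (rule prob_space_cube)
  have "integrable (cube d) (\<lambda>x. f x * \<phi> z x)" if "z \<in> Z" for z
    using f that assms \<phi>
    by (intro integrable_bounded_image bounded_mult_image borel_measurable_times)
       (auto simp: discriminators_def orthonormal_basis_def square_integrable_def)
  moreover have "f x * series_estimator \<phi> Z n X x
      = (\<Sum>z\<in>Z. emp_coeff \<phi> n X z * (f x * \<phi> z x))" for x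
    by (simp add: series_estimator_def sum_distrib_left mult.left_commute)
  ultimately have est: "(\<integral>x. f x * series_estimator \<phi> Z n X x \<partial>cube d)
      = (\<Sum>z\<in>Z. coeff d \<phi> f z * emp_coeff \<phi> n X z)"
    by (simp add: coeff_def mult.commute)
  let ?s = "\<Sum>z\<in>Z. coeff d \<phi> f z * prob_coeff \<phi> P z"
  have "\<bar>?s - (\<integral>x. f x * series_estimator \<phi> Z n X x \<partial>cube d)\<bar>
      = \<bar>\<Sum>z\<in>Z. coeff d \<phi> f z * (prob_coeff \<phi> P z - emp_coeff \<phi> n X z)\<bar>"
    unfolding est by (simp add: algebra_simps sum_subtractf)
  also have "\<dots> \<le> (\<Sum>z\<in>Z. \<bar>coeff d \<phi> f z * (prob_coeff \<phi> P z - emp_coeff \<phi> n X z)\<bar>)"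
    by (rule sum_abs)
  also have "\<dots> \<le> V" using V[OF f] by (simp add: abs_mult)
  finally have "\<bar>(\<integral>x. f x \<partial>P) - (\<integral>x. f x * series_estimator \<phi> Z n X x \<partial>cube d)\<bar>
      \<le> V + \<bar>(\<integral>x. f x \<partial>P) - ?s\<bar>" and V0: "0 \<le> V" by linarith+
  then have "ennreal \<bar>(\<integral>x. f x \<partial>P) - (\<integral>x. f x * series_estimator \<phi> Z n X x \<partial>cube d)\<bar>
      \<le> ennreal (V + \<bar>(\<integral>x. f x \<partial>P) - ?s\<bar>)"
    by (intro ennreal_leI)
  also have "\<dots> = ennreal V + ennreal \<bar>(\<integral>x. f x \<partial>P) - ?s\<bar>"
    using V0 by simp
  also have "\<dots> \<le> ennreal V + ennreal (L\<^sub>D * L\<^sub>G)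
        * lnorm (bias_exponent p q) (I - Z) (\<lambda>z. 1 / ennreal \<bar>a z * b z\<bar>)"
    using assms f by (intro add_left_mono discriminator_bias_le) auto
  finally show "ennreal \<bar>(\<integral>x. f x \<partial>P) - (\<integral>x. f x * series_estimator \<phi> Z n X x \<partial>cube d)\<bar>
      \<le> ennreal V + ennreal (L\<^sub>D * L\<^sub>G)
        * lnorm (bias_exponent p q) (I - Z) (\<lambda>z. 1 / ennreal \<bar>a z * b z\<bar>)" .
qed

section \<open>The expected loss\<close>

text \<open>Removes the indices with essential supremum 0: almost surely every observation falls
  where \<open>\<phi> z\<close> vanishes, so the true and the empirical coefficient are both
  0.\<close>

lemma emp_coeff_deviation_AE_0:
  assumes "prob_space P" and [measurable]: "\<phi> z \<in> borel_measurable P" and 0: "AE x in P. \<phi> z x = 0"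
  shows "AE X in (\<Pi>\<^sub>M i\<in>{..<n}. P). \<bar>prob_coeff \<phi> P z - emp_coeff \<phi> n X z\<bar> = 0"
proof -
  have "AE X in (\<Pi>\<^sub>M i\<in>{..<n}. P). \<forall>i\<in>{..<n}. \<phi> z (X i) = 0"
    using assms by (intro AE_finite_allI AE_PiM_component) auto
  moreover have "prob_coeff \<phi> P z = 0"
    unfolding prob_coeff_def using 0 by (rule integral_eq_zero_AE)
  ultimately show ?thesis
    by (auto simp: emp_coeff_def elim!: eventually_mono)
qed

text \<open>Unlike in Hoelder's inequality, the right-hand side is affine in the power sum of
  \<open>y\<close>, so its expectation needs only the moments of order \<open>r\<close>. If that
  power sum has expectation at most 1, the whole bound has expectation at most
  \<open>1/p + 1/r = 1\<close>.\<close>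

lemma Youngs_inequality_sum:
  fixes x y :: "'a \<Rightarrow> real"
  assumes "1 < p" "1 < r" "1/p + 1/r = 1"
    and "\<And>z. z \<in> F \<Longrightarrow> 0 \<le> x z" "\<And>z. z \<in> F \<Longrightarrow> 0 \<le> y z"
    and x: "(\<Sum>z\<in>F. x z powr p) \<le> 1"
  shows "(\<Sum>z\<in>F. x z * y z) \<le> 1/p + (\<Sum>z\<in>F. y z powr r) / r"
proof -
  have "(\<Sum>z\<in>F. x z * y z) \<le> (\<Sum>z\<in>F. x z powr p / p + y z powr r / r)"
    using assms by (intro sum_mono Youngs_inequality) auto
  also have "\<dots> = (\<Sum>z\<in>F. x z powr p) / p + (\<Sum>z\<in>F. y z powr r) / r"
    by (simp add: sum.distrib sum_divide_distrib)
  also have "\<dots> \<le> 1/p + (\<Sum>z\<in>F. y z powr r) / r"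
    using assms by (intro add_right_mono divide_right_mono) auto
  finally show ?thesis .
qed

lemma expected_adv_loss_le:
  fixes L\<^sub>D L\<^sub>G p q :: real
  assumes basis: "orthonormal_basis d I \<phi>"
    and \<phi>: "\<And>z. z \<in> I \<Longrightarrow> bounded (\<phi> z ` space (cube d))"
    and P: "P \<in> prob_ellipse d I \<phi> q b L\<^sub>G"
    and p: "1 \<le> p" and q: "1 \<le> q" and L: "0 < L\<^sub>D" "0 < L\<^sub>G"
    and Z: "finite Z" "Z \<subseteq> I" and n: "0 < n"
  shows "(\<integral>\<^sup>+X. adv_loss d (discriminators d I \<phi> p a L\<^sub>D P) P (series_estimator \<phi> Z n X)
          \<partial>(\<Pi>\<^sub>M i\<in>{..<n}. P))
       \<le> ennreal L\<^sub>D * (4 * conj_exponent p / ennreal (sqrt (real n)))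
             * lnorm (conj_exponent p) Z
                 (\<lambda>z. esssup P (\<lambda>x. ennreal \<bar>\<phi> z x\<bar>) / ennreal \<bar>a z\<bar>)
           + ennreal (L\<^sub>D * L\<^sub>G)
             * lnorm (bias_exponent p q) (I - Z) (\<lambda>z. 1 / ennreal \<bar>a z * b z\<bar>)"
    (is "(\<integral>\<^sup>+X. ?loss X \<partial>?Pn) \<le> ennreal L\<^sub>D * ?c * ?V + ?B")
proof -
  have "prob_space P" and sets_P: "sets P = sets (cube d)"
    using P by (auto simp: prob_ellipse_def)
  interpret prob_space P by fact
  interpret Pn: prob_space ?Pn by (intro prob_space_PiM \<open>prob_space P\<close>)
  have space_eq: "space P = space (cube d)" using sets_P by (rule sets_eq_imp_space_eq)
  have meas [measurable]: "\<phi> z \<in> borel_measurable P" if "z \<in> I" for z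
    using basis that measurable_cong_sets[OF sets_P refl]
    by (auto simp: orthonormal_basis_def square_integrable_def)
  define e where "e z = esssup P (\<lambda>x. ennreal \<bar>\<phi> z x\<bar>)" for z
  define m where "m z = enn2real (e z)" for z
  have m0: "0 \<le> m z" for z by (simp add: m_def)
  have e_eq: "e z = ennreal (m z)" if z: "z \<in> I" for z
  proof -
    obtain C where C: "\<forall>x\<in>space P. \<bar>\<phi> z x\<bar> \<le> C"
      using \<phi>[OF z] by (auto simp: bounded_iff space_eq)
    have [measurable]: "\<phi> z \<in> borel_measurable P" using z by (rule meas)
    have "e z \<le> ennreal C"
      unfolding e_def using C by (intro esssup_I) (auto intro!: AE_I2 ennreal_leI)
    then have "e z < \<top>" using ennreal_less_top by (rule le_less_trans)
    then show ?thesis by (simp add: m_def)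
  qed
  have bound: "AE x in P. \<bar>\<phi> z x\<bar> \<le> m z" if "z \<in> I" for z
    using esssup_AE[where M=P and f="\<lambda>x. ennreal \<bar>\<phi> z x\<bar>"] e_eq[OF that] m0 by (simp add: e_def)
  \<comment> \<open>On \<open>Z - Z'\<close> the error vanishes almost surely, so \<open>a z = 0\<close> is harmless there (the quotient
    is \<open>0 / 0 = 0\<close>); on \<open>Z'\<close> it makes the right-hand side infinite.\<close>
  define Z' where "Z' = {z\<in>Z. m z \<noteq> 0}"
  have Z': "finite Z'" "Z' \<subseteq> Z" "Z' \<subseteq> I" and m_pos: "\<And>z. z \<in> Z' \<Longrightarrow> 0 < m z"
    using Z m0 by (auto simp: Z'_def less_le)
  define dev where "dev X z = \<bar>prob_coeff \<phi> P z - emp_coeff \<phi> n X z\<bar>" for X z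
  have AE: "AE X in ?Pn. \<forall>z\<in>Z - Z'. dev X z = 0"
    unfolding dev_def
  proof (intro AE_finite_allI emp_coeff_deviation_AE_0)
    fix z assume "z \<in> Z - Z'"
    then have "m z = 0" "z \<in> I" using Z by (auto simp: Z'_def)
    then show "AE x in P. \<phi> z x = 0" using bound[of z] by simp
  qed (use Z meas \<open>prob_space P\<close> in auto)
  have loss_le: "?loss X \<le> ennreal V + ?B"
    if dev: "\<forall>z\<in>Z - Z'. dev X z = 0"
      and V: "\<And>f. f \<in> discriminators d I \<phi> p a L\<^sub>D P \<Longrightarrow> (\<Sum>z\<in>Z'. \<bar>coeff d \<phi> f z\<bar> * dev X z) \<le> V"
    for X V
  proof (rule adv_loss_series_estimator_le[OF basis \<phi> P p q L Z])
    fix f assume "f \<in> discriminators d I \<phi> p a L\<^sub>D P"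
    moreover have "(\<Sum>z\<in>Z. \<bar>coeff d \<phi> f z\<bar> * dev X z) = (\<Sum>z\<in>Z'. \<bar>coeff d \<phi> f z\<bar> * dev X z)"
      using dev Z Z' by (intro sum.mono_neutral_right) auto
    ultimately show "(\<Sum>z\<in>Z. \<bar>coeff d \<phi> f z\<bar> * \<bar>prob_coeff \<phi> P z - emp_coeff \<phi> n X z\<bar>) \<le> V"
      using V by (simp add: dev_def)
  qed auto
  have c_pos: "?c \<noteq> 0"
    using p by (auto simp: conj_exponent_def ennreal_divide_eq_0_iff ennreal_eq_0_iff)
  \<comment> \<open>In the first case only the bias remains almost surely. The second arises from a
    vanishing weight on \<open>Z'\<close>, which makes \<open>?V\<close> infinite, or from
    \<open>p = 1\<close>, where the constant is infinite; as \<open>\<infinity> * 0 = 0\<close>, the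
    latter also needs \<open>?V\<close> to be positive, which an index in \<open>Z'\<close>
    provides. The third case carries the moment estimate.\<close>
  consider "Z' = {}" | "Z' \<noteq> {}" "ennreal L\<^sub>D * ?c * ?V = \<infinity>"
    | "Z' \<noteq> {}" "1 < p" "\<And>z. z \<in> Z' \<Longrightarrow> a z \<noteq> 0"
  proof (cases "Z' = {}")
    case False
    then obtain z where z: "z \<in> Z'" "z \<in> Z" "z \<in> I" using Z' by auto
    show ?thesis
    proof (cases "1 < p \<and> (\<forall>z\<in>Z'. a z \<noteq> 0)")
      case True
      then show ?thesis using that False by auto
    next
      case False': False
      have "ennreal L\<^sub>D * ?c * ?V = \<infinity>"
      proof (cases "\<exists>z\<in>Z'. a z = 0")
        case True
        then obtain w where w: "w \<in> Z'" "a w = 0" by auto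
        have "?V = \<infinity>"
          using w m_pos[of w] e_eq[of w] Z'
          by (intro lnorm_eq_top[of w]) (auto simp flip: e_def)
        then show ?thesis using c_pos L by (simp add: ennreal_mult_eq_top_iff)
      next
        case no_zero: False
        then have "p = 1" using False' p by auto
        then have top: "conj_exponent p = \<infinity>" by (simp add: conj_exponent_def)
        have "0 < ennreal (m z) / ennreal \<bar>a z\<bar>"
          using m_pos[of z] z by (simp add: zero_less_iff_neq_zero ennreal_divide_eq_0_iff)
        also have "\<dots> \<le> ?V"
          unfolding top lnorm_def using z e_eq[of z]
          by (auto simp: e_def intro!: SUP_upper2[of z])
        finally show ?thesis
          using L top n by (auto simp: ennreal_mult_eq_top_iff ennreal_top_mult ennreal_top_divide)
      qed
      then show ?thesis using that False by auto
    qed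
  qed (use that in auto)
  then show ?thesis
  proof cases
    case 1
    have "AE X in ?Pn. ?loss X \<le> ?B"
      using AE
    proof eventually_elim
      case (elim X)
      then show ?case using loss_le[of X 0] 1 by simp
    qed
    then have "(\<integral>\<^sup>+X. ?loss X \<partial>?Pn) \<le> (\<integral>\<^sup>+X. ?B \<partial>?Pn)" by (rule nn_integral_mono_AE)
    also have "\<dots> = ?B" by (simp add: Pn.emeasure_space_1)
    finally show ?thesis by (rule order_trans) simp
  next
    case 2
    then show ?thesis by simp
  next
    case 3
    note a = 3(3)
    define r where "r = p / (p - 1)"
    have r: "1 < r" "1/p + 1/r = 1" using 3 by (auto simp: r_def field_simps)
    have conj: "conj_exponent p = ennreal r"
      using 3 by (simp add: conj_exponent_def r_def divide_ennreal)
    define S where "S = (\<Sum>z\<in>Z'. (m z / \<bar>a z\<bar>) powr r)"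
    \<comment> \<open>The target: \<open>L\<^sub>D * K\<close> is the stochastic term of the claim
      with its norm restricted to \<open>Z'\<close>.\<close>
    define K where "K = 4 * r / sqrt (real n) * S powr (1 / r)"
    have "0 < S"
      unfolding S_def using 3 Z' a m_pos by (intro sum_pos) (auto simp: less_le)
    then have K: "0 < K" using r n by (simp add: K_def)
    have "ennreal (S powr (1 / r)) = lnorm (ennreal r) Z' (\<lambda>z. ennreal (m z / \<bar>a z\<bar>))"
      unfolding S_def using Z' r m0 by (intro lnorm_finite_set[symmetric]) auto
    also have "\<dots> = lnorm (conj_exponent p) Z' (\<lambda>z. esssup P (\<lambda>x. ennreal \<bar>\<phi> z x\<bar>) / ennreal \<bar>a z\<bar>)"
      unfolding conj using Z' a m0 e_eq
      by (intro lnorm_cong) (auto simp: divide_ennreal simp flip: e_def)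
    also have "\<dots> \<le> ?V" using Z' by (intro lnorm_mono_set)
    finally have S_le: "ennreal (S powr (1 / r)) \<le> ?V" .
    have "4 * conj_exponent p = ennreal (4 * r)"
      using r by (simp add: conj ennreal_mult)
    then have "ennreal L\<^sub>D * ?c = ennreal (L\<^sub>D * (4 * r / sqrt (real n)))"
      using L r n by (simp add: divide_ennreal flip: ennreal_mult)
    then have "ennreal (L\<^sub>D * K) = ennreal L\<^sub>D * ?c * ennreal (S powr (1 / r))"
      using L r n by (simp add: K_def mult.assoc flip: ennreal_mult)
    also have "\<dots> \<le> ennreal L\<^sub>D * ?c * ?V"
      using S_le by (rule mult_left_mono) simp
    finally have main: "ennreal (L\<^sub>D * K) \<le> ennreal L\<^sub>D * ?c * ?V" .
    \<comment> \<open>The weights are shifted from the deviations to the coefficients of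
      \<open>f\<close>, where the ellipse controls them. \<open>G\<close> does not involve
      \<open>f\<close>, so the bound \<open>pair\<close> is uniform over the discriminators, and
      \<open>K\<close> is scaled to give \<open>G\<close> expectation at most 1.\<close>
    define G where "G X = (\<Sum>z\<in>Z'. (dev X z / (\<bar>a z\<bar> * K)) powr r)" for X
    have G0: "0 \<le> G X" for X by (simp add: G_def sum_nonneg)
    have dev_meas [measurable]: "(\<lambda>X. dev X z) \<in> borel_measurable ?Pn" if "z \<in> Z'" for z
    proof -
      have [measurable]: "\<phi> z \<in> borel_measurable P" using that Z' by (intro meas) auto
      show ?thesis unfolding dev_def emp_coeff_def by measurable
    qed
    have G_meas [measurable]: "G \<in> borel_measurable ?Pn" unfolding G_def by measurable
    have pair: "(\<Sum>z\<in>Z'. \<bar>coeff d \<phi> f z\<bar> * dev X z) \<le> L\<^sub>D * K * (1/p + G X / r)"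
      if f: "f \<in> discriminators d I \<phi> p a L\<^sub>D P" for f X
    proof -
      have "(\<Sum>z\<in>Z'. (\<bar>a z\<bar> * \<bar>coeff d \<phi> f z\<bar> / L\<^sub>D) powr p) \<le> 1"
        using f Z' p L by (intro coeff_ellipse_sum_le_1[where I=I]) (auto simp: discriminators_def ellipse_def)
      then have "(\<Sum>z\<in>Z'. \<bar>a z\<bar> * \<bar>coeff d \<phi> f z\<bar> / L\<^sub>D * (dev X z / (\<bar>a z\<bar> * K))) \<le> 1/p + G X / r"
        unfolding G_def using 3 r L K by (intro Youngs_inequality_sum) (auto simp: dev_def)
      then have "L\<^sub>D * K * (\<Sum>z\<in>Z'. \<bar>a z\<bar> * \<bar>coeff d \<phi> f z\<bar> / L\<^sub>D * (dev X z / (\<bar>a z\<bar> * K)))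
          \<le> L\<^sub>D * K * (1/p + G X / r)"
        using L K by (intro mult_left_mono) auto
      also have "L\<^sub>D * K * (\<Sum>z\<in>Z'. \<bar>a z\<bar> * \<bar>coeff d \<phi> f z\<bar> / L\<^sub>D * (dev X z / (\<bar>a z\<bar> * K)))
          = (\<Sum>z\<in>Z'. \<bar>coeff d \<phi> f z\<bar> * dev X z)"
        unfolding sum_distrib_left using L K a by (intro sum.cong) auto
      finally show ?thesis .
    qed
    have EG: "(\<integral>\<^sup>+X. ennreal (G X) \<partial>?Pn) \<le> 1"
    proof -
      have "(\<integral>\<^sup>+X. ennreal (G X) \<partial>?Pn)
          = (\<integral>\<^sup>+X. (\<Sum>z\<in>Z'. ennreal ((1 / (\<bar>a z\<bar> * K)) powr r) * ennreal (dev X z powr r)) \<partial>?Pn)"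
      proof (intro nn_integral_cong)
        fix X
        have "G X = (\<Sum>z\<in>Z'. (1 / (\<bar>a z\<bar> * K)) powr r * dev X z powr r)"
          unfolding G_def using K by (intro sum.cong) (auto simp: dev_def powr_divide powr_mult)
        then show "ennreal (G X)
            = (\<Sum>z\<in>Z'. ennreal ((1 / (\<bar>a z\<bar> * K)) powr r) * ennreal (dev X z powr r))"
          by (simp flip: ennreal_mult)
      qed
      also have "\<dots> = (\<Sum>z\<in>Z'. ennreal ((1 / (\<bar>a z\<bar> * K)) powr r) * (\<integral>\<^sup>+X. ennreal (dev X z powr r) \<partial>?Pn))"
        by (subst nn_integral_sum) (auto intro!: sum.cong nn_integral_cmult)
      also have "\<dots> \<le> (\<Sum>z\<in>Z'. ennreal ((1 / (\<bar>a z\<bar> * K)) powr r)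
            * ennreal ((4 * r * m z / sqrt (real n)) powr r))"
      proof (intro sum_mono mult_left_mono)
        fix z assume z: "z \<in> Z'"
        then show "(\<integral>\<^sup>+X. ennreal (dev X z powr r) \<partial>?Pn) \<le> ennreal ((4 * r * m z / sqrt (real n)) powr r)"
          unfolding dev_def emp_coeff_def prob_coeff_def using Z' r m_pos n
          by (intro nn_integral_mean_deviation_powr_le meas bound) auto
      qed simp
      \<comment> \<open>The factor \<open>4 * r / sqrt n\<close> cancels against the one in
        \<open>K\<close>, leaving the share of \<open>z\<close> in \<open>S\<close>; these shares
        sum to 1.\<close>
      also have "\<dots> = (\<Sum>z\<in>Z'. ennreal ((m z / \<bar>a z\<bar>) powr r / S))"
      proof (rule sum.cong[OF refl])
        fix z assume z: "z \<in> Z'"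
        have "1 / (\<bar>a z\<bar> * K) * (4 * r * m z / sqrt (real n)) = (m z / \<bar>a z\<bar>) / S powr (1 / r)"
          using r n \<open>0 < S\<close> a[OF z] by (simp add: K_def field_simps)
        then have "(1 / (\<bar>a z\<bar> * K)) powr r * (4 * r * m z / sqrt (real n)) powr r
            = ((m z / \<bar>a z\<bar>) / S powr (1 / r)) powr r"
          using K r m0 by (subst powr_mult[symmetric]) auto
        also have "\<dots> = (m z / \<bar>a z\<bar>) powr r / S"
          using r \<open>0 < S\<close> m0 by (subst powr_divide) (auto simp: powr_powr)
        finally show "ennreal ((1 / (\<bar>a z\<bar> * K)) powr r) * ennreal ((4 * r * m z / sqrt (real n)) powr r)
            = ennreal ((m z / \<bar>a z\<bar>) powr r / S)"
          by (simp flip: ennreal_mult)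
      qed
      also have "\<dots> = ennreal (S / S)"
        using \<open>0 < S\<close> S_def by (subst sum_ennreal) (simp_all flip: sum_divide_distrib)
      finally show ?thesis using \<open>0 < S\<close> by simp
    qed
    have "AE X in ?Pn. ?loss X \<le> ennreal (L\<^sub>D * K * (1/p + G X / r)) + ?B"
      using AE
    proof eventually_elim
      case (elim X)
      then show ?case by (intro loss_le pair) auto
    qed
    \<comment> \<open>Monotonicity alone leads from the loss, a supremum over a possibly uncountable
      class, to a measurable majorant.\<close>
    then have "(\<integral>\<^sup>+X. ?loss X \<partial>?Pn) \<le> (\<integral>\<^sup>+X. ennreal (L\<^sub>D * K * (1/p + G X / r)) + ?B \<partial>?Pn)"
      by (rule nn_integral_mono_AE)
    also have "\<dots> = (\<integral>\<^sup>+X. (ennreal (L\<^sub>D * K / p) + ennreal (L\<^sub>D * K / r) * ennreal (G X)) + ?B \<partial>?Pn)"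
      using L K G0 r 3
      by (intro nn_integral_cong) (simp add: distrib_left flip: ennreal_mult ennreal_plus)
    also have "\<dots> = ennreal (L\<^sub>D * K / p) + ennreal (L\<^sub>D * K / r) * (\<integral>\<^sup>+X. ennreal (G X) \<partial>?Pn) + ?B"
      by (simp add: nn_integral_add nn_integral_cmult Pn.emeasure_space_1)
    also have "\<dots> \<le> ennreal (L\<^sub>D * K / p) + ennreal (L\<^sub>D * K / r) * 1 + ?B"
      by (intro add_mono mult_left_mono EG) auto
    \<comment> \<open>Since \<open>1/p + 1/r = 1\<close>, the two pieces from Young's inequality
      recombine exactly into the target.\<close>
    also have "ennreal (L\<^sub>D * K / p) + ennreal (L\<^sub>D * K / r) * 1 = ennreal (L\<^sub>D * K)"
    proof -
      have "L\<^sub>D * K / p + L\<^sub>D * K / r = L\<^sub>D * K * (1/p + 1/r)"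
        by (simp only: distrib_left times_divide_eq_right mult_1_right)
      then show ?thesis
        using L K r 3 by (simp flip: ennreal_plus)
    qed
    also have "\<dots> + ?B \<le> ennreal L\<^sub>D * ?c * ?V + ?B" using main by (rule add_right_mono)
    finally show ?thesis .
  qed
qed

theorem theorem1:
  shows "\<exists>c :: ennreal \<Rightarrow> ennreal.
    (\<forall>r. r < \<infinity> \<longrightarrow> c r < \<infinity>) \<and>
    (\<forall>(d :: nat) (I :: 'z set) (\<phi> :: 'z \<Rightarrow> (nat \<Rightarrow> real) \<Rightarrow> real) (p :: real) (q :: real)
       (a :: 'z \<Rightarrow> real) (b :: 'z \<Rightarrow> real) (L\<^sub>D :: real) (L\<^sub>G :: real) (Z :: 'z set) (n :: nat)
       (P :: (nat \<Rightarrow> real) measure).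
       countable I \<longrightarrow>
       orthonormal_basis d I \<phi> \<longrightarrow>
       (\<forall>z\<in>I. bounded (\<phi> z ` space (cube d))) \<longrightarrow>
       1 \<le> p \<longrightarrow> 1 \<le> q \<longrightarrow> 0 < L\<^sub>D \<longrightarrow> 0 < L\<^sub>G \<longrightarrow>
       finite Z \<longrightarrow> Z \<subseteq> I \<longrightarrow> 0 < n \<longrightarrow>
       P \<in> prob_ellipse d I \<phi> q b L\<^sub>G \<longrightarrow>
       (\<integral>\<^sup>+X. adv_loss d (discriminators d I \<phi> p a L\<^sub>D P) P (series_estimator \<phi> Z n X)
          \<partial>(\<Pi>\<^sub>M i\<in>{..<n}. P))
       \<le> ennreal L\<^sub>D * (c (conj_exponent p) / ennreal (sqrt (real n)))
             * lnorm (conj_exponent p) Z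
                 (\<lambda>z. esssup P (\<lambda>x. ennreal \<bar>\<phi> z x\<bar>) / ennreal \<bar>a z\<bar>)
           + ennreal (L\<^sub>D * L\<^sub>G)
             * lnorm (bias_exponent p q) (I - Z) (\<lambda>z. 1 / ennreal \<bar>a z * b z\<bar>))"
\<comment> \<open>The witness is the moment constant at \<open>r = p / (p - 1)\<close>; it is
  infinite only for the exponent \<open>\<infinity>\<close>, that is, for
  \<open>p = 1\<close>.\<close>
proof (intro exI[of _ "\<lambda>r. 4 * r"] conjI allI impI)
  fix r :: ennreal assume "r < \<infinity>"
  then show "4 * r < \<infinity>" by (simp add: ennreal_mult_less_top)
qed (rule expected_adv_loss_le; auto)

end
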